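(* Let $\mu_1,\dots,\mu_6$ be the following commutative associative laws on $\mathbb R^2$ with basis $\{e_1,e_2\}$ (products are extended by commutativity, and products not listed are zero): - $\mu_1$: $\mu_1(e_1,e_1)=e_1$, $\mu_1(e_1,e_2)=e_2$, $\mu_1(e_2,e_2)=e_2$; - $\mu_2$: $\mu_2(e_1,e_1)=e_1$, $\mu_2(e_1,e_2)=e_2$, $\mu_2(e_2,e_2)=0$; - $\mu_3$: $\mu_3(e_1,e_1)=e_1$, $\mu_3(e_1,e_2)=e_2$, $\mu_3(e_2,e_2)=-e_1$; - $\mu_4$: $\mu_4(e_1,e_1)=e_2$; - $\mu_5=0$; - $\mu_6$: $\mu_6(e_1,e_1)=e_1$. Let $A_i$ be the affine structure on the $2$-dimensional real abelian Lie algebra corresponding to $\mu_i$. Then the affine structures $A_1$ and $A_3$ are rigid, and each of the other structures $A_2,A_4,A_5,A_6$ can be deformed into $A_1$ or $A_3$.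
   Context: An affine structure on a real Lie algebra $\mathfrak g$ of dimension $n$ is a Lie algebra morphism $\Psi:\mathfrak g\to\mathrm{aff}(\mathbb R^n)$, $\Psi(X)=\begin{pmatrix}A(X)&b(X)\\0&0\end{pmatrix}$, with $b:\mathfrak g\to\mathbb R^n$ bijective. It corresponds to the product $X\cdot Y=b^{-1}(A(X)b(Y))$ on $\mathfrak g$. If $\mathfrak g$ is abelian, this product is commutative and associative. Conversely, a commutative associative product $\mu$ on $\mathbb R^n$ gives the affine structure $X\mapsto\begin{pmatrix}L_X&X\\0&0\end{pmatrix}$, $L_X(Y)=\mu(X,Y)$, on the abelian Lie algebra $\mathbb R^n$. Let $\mathcal A^c(n)$ be the set of commutative associative (not necessarily unitary) bilinear laws $\mu:\mathbb R^n\times\mathbb R^n\to\mathbb R^n$. It is identified, via structure constants $\mu(e_i,e_j)=\sum_k C_{ij}^k e_k$, with a real algebraic subset of $\mathbb R^{n^3}$ and given the topology induced from $\mathbb R^{n^3}$. The group $GL(n,\mathbb R)$ acts on it by $\mu_f(x,y)=f^{-1}\mu(f(x),f(y))$; the orbit of $\mu$ is denoted $\theta(\mu)$. The law $\mu$ is rigid if $\theta(\mu)$ is open in $\mathcal A^c(n)$. An affine structure on an abelian Lie algebra is rigid if its corresponding law is rigid in $\mathcal A^c(n)$. The structure corresponding to $\mu$ can be deformed into the structure corresponding to $\mu'$ if $\mu\in\overline{\theta(\mu')}$ (closure in $\mathcal A^c(n)$). *)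

theory Defs
  imports "HOL-Analysis.Analysis"
begin

locale real_lie_algebra =
  fixes br :: "'g::real_vector \<Rightarrow> 'g \<Rightarrow> 'g"
  assumes bilinear_br: "bilinear br"
    and alternating: "br x x = 0"
    and jacobi: "br x (br y z) + br y (br z x) + br z (br x y) = 0"

definition abelian_bracket :: "'g::real_vector \<Rightarrow> 'g \<Rightarrow> 'g" where
  "abelian_bracket = (\<lambda>x y. 0)"


subsection \<open>Affine structures\<close>

text \<open>
  Matrices of size \<open>n + 1\<close> are indexed by \<^typ>\<open>'n option\<close>; the index \<^const>\<open>None\<close> stands for the
  last row and column.
\<close>

definition aff :: "(real ^ ('n::finite) option ^ 'n option) set" where
  "aff = {M. \<forall>j. M $ None $ j = 0}"

definition aff_matrix :: "real ^ 'n ^ 'n \<Rightarrow> real ^ 'n \<Rightarrow> real ^ ('n::finite) option ^ 'n option" where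
  "aff_matrix A b =
    (\<chi> i j. case i of None \<Rightarrow> 0
      | Some i' \<Rightarrow> (case j of None \<Rightarrow> b $ i' | Some j' \<Rightarrow> A $ i' $ j'))"

definition linear_part :: "real ^ ('n::finite) option ^ 'n option \<Rightarrow> real ^ 'n ^ 'n" where
  "linear_part M = (\<chi> i j. M $ Some i $ Some j)"

definition translation_part :: "real ^ ('n::finite) option ^ 'n option \<Rightarrow> real ^ 'n" where
  "translation_part M = (\<chi> i. M $ Some i $ None)"

text \<open>
  The dimension of the Lie algebra needs no separate assumption: the translation part is a linear
  bijection onto \<^typ>\<open>real ^ 'n\<close>.
\<close>

definition affine_structure ::
  "('g::real_vector \<Rightarrow> 'g \<Rightarrow> 'g) \<Rightarrow> ('g \<Rightarrow> real ^ ('n::finite) option ^ 'n option) \<Rightarrow> bool" where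
  "affine_structure br \<Psi> \<longleftrightarrow>
    real_lie_algebra br \<and>
    linear \<Psi> \<and> range \<Psi> \<subseteq> aff \<and>
    (\<forall>X Y. \<Psi> (br X Y) = \<Psi> X ** \<Psi> Y - \<Psi> Y ** \<Psi> X) \<and>
    bij (\<lambda>X. translation_part (\<Psi> X))"

definition affine_product ::
  "('g::real_vector \<Rightarrow> real ^ ('n::finite) option ^ 'n option) \<Rightarrow> 'g \<Rightarrow> 'g \<Rightarrow> 'g" where
  "affine_product \<Psi> X Y =
    inv (\<lambda>Z. translation_part (\<Psi> Z)) (linear_part (\<Psi> X) *v translation_part (\<Psi> Y))"


subsection \<open>Commutative associative laws\<close>

type_synonym 'n law = "real ^ 'n \<Rightarrow> real ^ 'n \<Rightarrow> real ^ 'n"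

definition comm_assoc_laws :: "('n::finite) law set" where
  "comm_assoc_laws =
    {\<mu>. bilinear \<mu> \<and> (\<forall>x y. \<mu> x y = \<mu> y x) \<and> (\<forall>x y z. \<mu> (\<mu> x y) z = \<mu> x (\<mu> y z))}"

definition structure_constants :: "('n::finite) law \<Rightarrow> real ^ 'n ^ 'n ^ 'n" where
  "structure_constants \<mu> = (\<chi> i j k. \<mu> (axis i 1) (axis j 1) $ k)"

definition law_topology :: "('n::finite) law topology" where
  "law_topology = pullback_topology comm_assoc_laws structure_constants euclidean"

definition orbit :: "('n::finite) law \<Rightarrow> 'n law set" where
  "orbit \<mu> = {(\<lambda>x y. inv f (\<mu> (f x) (f y))) | f. linear f \<and> bij f}"

definition rigid_law :: "('n::finite) law \<Rightarrow> bool" where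
  "rigid_law \<mu> \<longleftrightarrow> \<mu> \<in> comm_assoc_laws \<and> openin law_topology (orbit \<mu>)"

definition affine_structure_of_law ::
  "('n::finite) law \<Rightarrow> real ^ 'n \<Rightarrow> real ^ 'n option ^ 'n option" where
  "affine_structure_of_law \<mu> X = aff_matrix (matrix (\<mu> X)) X"

text \<open>
  Rigidity and deformation are stated for affine structures on the abelian Lie algebra
  \<^typ>\<open>real ^ 'n\<close>, so that the corresponding product is itself a law on \<^typ>\<open>real ^ 'n\<close>.
\<close>

definition rigid_affine_structure ::
  "(real ^ 'n \<Rightarrow> real ^ ('n::finite) option ^ 'n option) \<Rightarrow> bool" where
  "rigid_affine_structure \<Psi> \<longleftrightarrow>
    affine_structure abelian_bracket \<Psi> \<and> rigid_law (affine_product \<Psi>)"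

definition deformable_into ::
  "(real ^ 'n \<Rightarrow> real ^ ('n::finite) option ^ 'n option) \<Rightarrow>
   (real ^ 'n \<Rightarrow> real ^ 'n option ^ 'n option) \<Rightarrow> bool" where
  "deformable_into \<Psi> \<Psi>' \<longleftrightarrow>
    affine_structure abelian_bracket \<Psi> \<and> affine_structure abelian_bracket \<Psi>' \<and>
    affine_product \<Psi> \<in> law_topology closure_of orbit (affine_product \<Psi>')"


subsection \<open>The correspondence between laws and affine structures\<close>

lemma parts_aff_matrix [simp]:
  "linear_part (aff_matrix A b) = A" "translation_part (aff_matrix A b) = b"
  by (simp_all add: linear_part_def translation_part_def aff_matrix_def vec_eq_iff)

lemma law_linear_right: "\<mu> \<in> comm_assoc_laws \<Longrightarrow> linear (\<mu> X)"
  by (simp add: comm_assoc_laws_def bilinear_def)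

lemma sum_UNIV_option:
  fixes f :: "'n::finite option \<Rightarrow> real"
  shows "sum f UNIV = f None + (\<Sum>i\<in>UNIV. f (Some i))"
  by (simp add: UNIV_option_conv sum.reindex)

lemma aff_matrix_mult: "aff_matrix A b ** aff_matrix A' b' = aff_matrix (A ** A') (A *v b')"
  by (auto simp: vec_eq_iff aff_matrix_def matrix_matrix_mult_def matrix_vector_mult_def
      sum_UNIV_option split: option.splits)

lemma affine_product_of_law:
  assumes "\<mu> \<in> comm_assoc_laws"
  shows "affine_product (affine_structure_of_law \<mu>) = \<mu>"
  by (intro ext)
    (simp add: affine_product_def affine_structure_of_law_def matrix_works
      law_linear_right[OF assms] inv_equality)

lemma affine_structure_of_law:
  assumes "\<mu> \<in> comm_assoc_laws"
  shows "affine_structure abelian_bracket (affine_structure_of_law \<mu>)"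
proof -
  have bil: "bilinear \<mu>" and comm: "\<mu> x y = \<mu> y x"
    and assoc: "\<mu> (\<mu> x y) z = \<mu> x (\<mu> y z)" for x y z
    using assms by (auto simp: comm_assoc_laws_def)
  have lie: "real_lie_algebra (abelian_bracket :: real ^ 'a \<Rightarrow> _)"
    by unfold_locales
      (auto simp: abelian_bracket_def bilinear_def intro: module_hom_zero)
  have lin: "linear (affine_structure_of_law \<mu>)"
    by (rule linearI)
      (auto simp: affine_structure_of_law_def aff_matrix_def matrix_def vec_eq_iff
        bilinear_ladd[OF bil] bilinear_lmul[OF bil] split: option.splits)
  have "\<mu> X (\<mu> Y z) = \<mu> Y (\<mu> X z)" for X Y z
    by (metis assoc comm)
  hence "matrix (\<mu> X) ** matrix (\<mu> Y) = matrix (\<mu> Y) ** matrix (\<mu> X)" for X Y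
    using law_linear_right[OF assms] by (simp add: matrix_compose[symmetric] o_def)
  hence hom: "affine_structure_of_law \<mu> (abelian_bracket X Y) =
      affine_structure_of_law \<mu> X ** affine_structure_of_law \<mu> Y
      - affine_structure_of_law \<mu> Y ** affine_structure_of_law \<mu> X" for X Y
    using linear_0[OF lin]
    by (simp add: abelian_bracket_def affine_structure_of_law_def aff_matrix_mult matrix_works
        law_linear_right[OF assms] comm[of X Y])
  have "range (affine_structure_of_law \<mu>) \<subseteq> aff"
    by (auto simp: affine_structure_of_law_def aff_matrix_def aff_def)
  moreover have "bij (\<lambda>X. translation_part (affine_structure_of_law \<mu> X))"
    unfolding affine_structure_of_law_def parts_aff_matrix by (rule bij_id[unfolded id_def])
  ultimately show ?thesis
    unfolding affine_structure_def using lie lin hom by blast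
qed


subsection \<open>Laws on the plane\<close>

definition comm_law2 :: "real ^ 2 \<Rightarrow> real ^ 2 \<Rightarrow> real ^ 2 \<Rightarrow> 2 law" where
  \<comment> \<open>the symmetric bilinear law with \<open>e\<^sub>1 e\<^sub>1 = p\<close>, \<open>e\<^sub>1 e\<^sub>2 = e\<^sub>2 e\<^sub>1 = q\<close> and \<open>e\<^sub>2 e\<^sub>2 = r\<close>\<close>
  "comm_law2 p q r x y =
    (x $ 1 * y $ 1) *\<^sub>R p + (x $ 1 * y $ 2 + x $ 2 * y $ 1) *\<^sub>R q + (x $ 2 * y $ 2) *\<^sub>R r"

abbreviation e1 :: "real ^ 2" where "e1 \<equiv> axis 1 1"
abbreviation e2 :: "real ^ 2" where "e2 \<equiv> axis 2 1"

definition mu1 :: "2 law" where "mu1 = comm_law2 e1 e2 e2"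
definition mu2 :: "2 law" where "mu2 = comm_law2 e1 e2 0"
definition mu3 :: "2 law" where "mu3 = comm_law2 e1 e2 (- e1)"
definition mu4 :: "2 law" where "mu4 = comm_law2 e2 0 0"
definition mu5 :: "2 law" where "mu5 = comm_law2 0 0 0"
definition mu6 :: "2 law" where "mu6 = comm_law2 e1 0 0"

lemma mu_comm_assoc:
  "mu1 \<in> comm_assoc_laws" "mu2 \<in> comm_assoc_laws" "mu3 \<in> comm_assoc_laws"
  "mu4 \<in> comm_assoc_laws" "mu5 \<in> comm_assoc_laws" "mu6 \<in> comm_assoc_laws"
  by (auto simp: comm_assoc_laws_def bilinear_def mu1_def mu2_def mu3_def mu4_def mu5_def mu6_def
      comm_law2_def vec_eq_iff forall_2 axis_def algebra_simps intro!: linearI)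

end

theory Submission imports Defs begin

text \<open>
  If \<open>x\<close> and \<open>x\<^sup>2\<close> span the plane, then \<open>x\<^sup>3 = a x\<^sup>2 + b x\<close>, and for \<open>b \<noteq> 0\<close> the algebra is unital and
  isomorphic to the quotient of the polynomial ring by \<open>t\<^sup>2 - a t - b\<close>. Hence it is isomorphic to
  \<open>\<real> \<times> \<real>\<close> (the law \<open>mu1\<close>) or to \<open>\<complex>\<close> (the law \<open>mu3\<close>) according to the sign of \<open>a\<^sup>2 + 4 b\<close>. For
  fixed \<open>x\<close> these are open conditions on the structure constants, so both orbits are open. Each of
  the remaining laws is the limit of an explicit curve of laws satisfying the conditions with
  \<open>a\<^sup>2 + 4 b > 0\<close>.
\<close>

section \<open>Orbits and the topology on laws\<close>

lemma orbit_subset_comm_assoc_laws: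
  assumes "\<mu> \<in> comm_assoc_laws"
  shows "orbit \<mu> \<subseteq> comm_assoc_laws"
proof
  fix \<nu> assume "\<nu> \<in> orbit \<mu>"
  then obtain f where f: "linear f" "bij f" and \<nu>: "\<nu> = (\<lambda>x y. inv f (\<mu> (f x) (f y)))"
    by (auto simp: orbit_def)
  have bil: "bilinear \<mu>" and comm: "\<And>x y. \<mu> x y = \<mu> y x"
    and assoc: "\<And>x y z. \<mu> (\<mu> x y) z = \<mu> x (\<mu> y z)"
    using assms by (auto simp: comm_assoc_laws_def)
  have g: "linear (inv f)"
    using f by (simp add: bij_is_inj linear_inj_imp_surj inj_linear_imp_inv_linear)
  have ff: "f (inv f x) = x" for x
    using f(2) by (simp add: bij_is_surj surj_f_inv_f)
  have "bilinear \<nu>"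
    unfolding bilinear_def \<nu>
    by (auto intro!: linearI simp: linear_add[OF f(1)] linear_scale[OF f(1)] linear_add[OF g]
        linear_scale[OF g] bilinear_ladd[OF bil] bilinear_radd[OF bil] bilinear_lmul[OF bil]
        bilinear_rmul[OF bil])
  then show "\<nu> \<in> comm_assoc_laws"
    by (simp add: comm_assoc_laws_def \<nu> ff assoc) (simp add: comm)
qed

text \<open>The definition of \<open>orbit\<close> pulls a law back along \<open>f\<close>, so an
  isomorphism \<open>g\<close> from \<open>\<nu>\<close> to \<open>\<mu>\<close> enters as
  \<open>f = inv g\<close>.\<close>

lemma mem_orbitI:
  assumes g: "linear g" "bij g" and hom: "\<And>x y. g (\<nu> x y) = \<mu> (g x) (g y)"
  shows "\<mu> \<in> orbit \<nu>"
proof -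
  have lin: "linear (inv g)"
    using g by (simp add: bij_is_inj inj_linear_imp_inv_linear)
  have "\<mu> x y = inv (inv g) (\<nu> (inv g x) (inv g y))" for x y
    using g(2) by (simp add: inv_inv_eq hom bij_is_surj surj_f_inv_f)
  then show ?thesis
    unfolding orbit_def using lin bij_imp_bij_inv[OF g(2)] by blast
qed

text \<open>Left inverse of \<open>structure_constants\<close> on bilinear laws. It is defined for
  every array of constants, associative or not, so openness can be checked in the whole Euclidean
  space.\<close>

definition law_of_constants :: "real ^ 'n ^ 'n ^ 'n \<Rightarrow> ('n::finite) law" where
  "law_of_constants C x y = (\<Sum>i\<in>UNIV. \<Sum>j\<in>UNIV. (x $ i * y $ j) *\<^sub>R C $ i $ j)"

lemma law_of_structure_constants:
  assumes "bilinear \<mu>"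
  shows "law_of_constants (structure_constants \<mu>) = \<mu>"
proof (intro ext)
  fix x y
  have C: "structure_constants \<mu> $ i $ j = \<mu> (axis i 1) (axis j 1)" for i j
    by (simp add: structure_constants_def vec_eq_iff)
  have "\<mu> x y = \<mu> (\<Sum>i\<in>UNIV. x $ i *\<^sub>R axis i 1) (\<Sum>j\<in>UNIV. y $ j *\<^sub>R axis j 1)"
    by (simp add: basis_expansion flip: scalar_mult_eq_scaleR)
  also have "\<dots> = law_of_constants (structure_constants \<mu>) x y"
    by (simp add: bilinear_sum[OF assms] law_of_constants_def C bilinear_lmul[OF assms]
        bilinear_rmul[OF assms] sum.cartesian_product mult.commute)
  finally show "law_of_constants (structure_constants \<mu>) x y = \<mu> x y" by simp
qed

lemma continuous_on_law_of_constants [continuous_intros]: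
  assumes "continuous_on S f" "continuous_on S g"
  shows "continuous_on S (\<lambda>C. law_of_constants C (f C) (g C))"
  unfolding law_of_constants_def by (intro continuous_intros assms)

lemma openin_law_topologyI:
  assumes "open V"
  shows "openin law_topology {\<mu> \<in> comm_assoc_laws. structure_constants \<mu> \<in> V}"
  unfolding law_topology_def openin_pullback_topology
  using assms by (intro exI[of _ V]) auto

lemma mem_closure_of_law_topology:
  assumes \<mu>: "\<mu> \<in> comm_assoc_laws" and "F \<noteq> bot"
    and lim: "((\<lambda>t. structure_constants (\<nu> t)) \<longlongrightarrow> structure_constants \<mu>) F"
    and ev: "\<forall>\<^sub>F t in F. \<nu> t \<in> S \<inter> comm_assoc_laws"
  shows "\<mu> \<in> law_topology closure_of S"
proof -
  have "\<exists>\<nu>'\<in>S. \<nu>' \<in> T" if T: "openin law_topology T" "\<mu> \<in> T" for T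
  proof -
    obtain V where V: "open V" "T = structure_constants -` V \<inter> comm_assoc_laws"
      using T(1) unfolding law_topology_def openin_pullback_topology by (auto simp flip: open_openin)
    have "\<forall>\<^sub>F t in F. structure_constants (\<nu> t) \<in> V"
      using V T(2) by (intro topological_tendstoD[OF lim]) auto
    then have "\<forall>\<^sub>F t in F. \<nu> t \<in> S \<and> \<nu> t \<in> T"
      using ev by eventually_elim (simp add: V)
    then show ?thesis
      using eventually_happens'[OF \<open>F \<noteq> bot\<close>] by blast
  qed
  moreover have "\<mu> \<in> topspace law_topology"
    using \<mu> by (simp add: law_topology_def topspace_pullback_topology)
  ultimately show ?thesis
    unfolding in_closure_of by blast
qed

section \<open>Generic laws on the plane\<close>

definition det2 :: "real ^ 2 \<Rightarrow> real ^ 2 \<Rightarrow> real" where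
  "det2 u v = u $ 1 * v $ 2 - u $ 2 * v $ 1"

text \<open>
  With \<open>x\<^sup>3 = a x\<^sup>2 + b x\<close> and \<open>d = det2 x x\<^sup>2\<close>, the two determinants involving \<open>x\<^sup>3\<close> are \<open>a d\<close> and
  \<open>b d\<close>, so the last conjunct says that \<open>s\<close> and \<open>a\<^sup>2 + 4 b\<close> have the same sign.
\<close>

definition generic_at :: "real \<Rightarrow> 2 law \<Rightarrow> real ^ 2 \<Rightarrow> bool" where
  "generic_at s \<mu> x \<longleftrightarrow>
    det2 x (\<mu> x x) \<noteq> 0 \<and> det2 (\<mu> x (\<mu> x x)) (\<mu> x x) \<noteq> 0 \<and>
    0 < s * ((det2 x (\<mu> x (\<mu> x x)))\<^sup>2 + 4 * det2 x (\<mu> x x) * det2 (\<mu> x (\<mu> x x)) (\<mu> x x))"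

lemma det2_linear:
  assumes "linear g"
  shows "det2 (g u) (g v) = det (matrix g) * det2 u v"
proof -
  have "g w = matrix g *v w" for w
    by (simp add: matrix_works assms)
  then show ?thesis
    by (simp add: det2_def det_2 matrix_vector_mult_def sum_2 algebra_simps)
qed

text \<open>Cramer's rule for the coordinates of \<open>w\<close> in the basis \<open>u\<close>,
  \<open>v\<close>.\<close>

lemma det2_expansion:
  assumes "det2 u v \<noteq> 0"
  shows "w = (det2 w v / det2 u v) *\<^sub>R u + (det2 u w / det2 u v) *\<^sub>R v"
  using assms by (simp add: vec_eq_iff forall_2 field_simps) (simp add: det2_def algebra_simps)

text \<open>An isomorphism multiplies each determinant in \<open>generic_at\<close> by its own
  determinant \<open>k\<close>. The discriminant is quadratic in them, hence scales by
  \<open>k\<^sup>2\<close> and keeps its sign.\<close>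

lemma orbit_generic_at:
  assumes \<mu>: "\<mu> \<in> orbit \<nu>" and x: "generic_at s \<nu> x"
  shows "\<exists>y. generic_at s \<mu> y"
proof -
  obtain f where f: "linear f" "bij f" and \<mu>: "\<mu> = (\<lambda>x y. inv f (\<nu> (f x) (f y)))"
    using \<mu> by (auto simp: orbit_def)
  define g where "g = inv f"
  have g: "linear g" "bij g"
    unfolding g_def using f by (simp_all add: bij_is_inj inj_linear_imp_inv_linear bij_imp_bij_inv)
  have ff: "f (g x) = x" for x
    using f(2) by (simp add: g_def bij_is_surj surj_f_inv_f)
  have hom: "\<mu> (g u) (g v) = g (\<nu> u v)" for u v
    by (simp add: \<mu> ff flip: g_def)
  define k where "k = det (matrix g)"
  have k: "k \<noteq> 0"
    using det_nz_iff_inj[OF g(1)] g(2) by (simp add: k_def bij_is_inj)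
  have scale: "s * ((k * A)\<^sup>2 + 4 * (k * B) * (k * C)) = k\<^sup>2 * (s * (A\<^sup>2 + 4 * B * C))" for A B C
    by (simp add: power2_eq_square algebra_simps)
  have "generic_at s \<mu> (g x)"
    using x k unfolding generic_at_def hom det2_linear[OF g(1)] k_def[symmetric] scale
    by (simp add: mult_pos_pos[of "k\<^sup>2"])
  then show ?thesis ..
qed

text \<open>The isomorphism sends \<open>e1\<close>, \<open>e2\<close> to \<open>u\<close>,
  \<open>v\<close>; its determinant is \<open>det2 u v\<close>. Thus an orbit is recognised by a
  multiplication table in some basis.\<close>

lemma mem_orbit_comm_law2:
  assumes bil: "bilinear \<mu>" and comm: "\<mu> v u = \<mu> u v" and uv: "det2 u v \<noteq> 0"
    and "\<mu> u u = p $ 1 *\<^sub>R u + p $ 2 *\<^sub>R v"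
    and "\<mu> u v = q $ 1 *\<^sub>R u + q $ 2 *\<^sub>R v"
    and "\<mu> v v = r $ 1 *\<^sub>R u + r $ 2 *\<^sub>R v"
  shows "\<mu> \<in> orbit (comm_law2 p q r)"
proof -
  define g where "g = (\<lambda>a :: real ^ 2. a $ 1 *\<^sub>R u + a $ 2 *\<^sub>R v)"
  have g: "linear g"
    unfolding g_def by (rule linearI) (simp_all add: algebra_simps)
  have "det (matrix g) \<noteq> 0"
    using uv by (simp add: g_def matrix_def det_2 det2_def axis_def algebra_simps)
  then have inj: "inj g"
    by (simp add: det_nz_iff_inj[OF g])
  have "bij g"
    using inj linear_inj_imp_surj[OF g inj] by (simp add: bij_def)
  moreover have "g (comm_law2 p q r a b) = \<mu> (g a) (g b)" for a b
    unfolding g_def comm_law2_def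
    by (simp add: bilinear_ladd[OF bil] bilinear_radd[OF bil] bilinear_lmul[OF bil]
        bilinear_rmul[OF bil] comm assms(4-6) algebra_simps)
  ultimately show ?thesis
    by (rule mem_orbitI[OF g])
qed

text \<open>Since \<open>b \<noteq> 0\<close>, the cubic relation for \<open>x\<close> produces a
  unit \<open>w\<close>; completing the square then gives an element \<open>j\<close> whose square
  is the discriminant times \<open>w\<close>.\<close>

lemma generic_at_unit_and_root:
  assumes \<mu>: "\<mu> \<in> comm_assoc_laws" and x: "generic_at s \<mu> x"
  obtains w j \<delta> where "\<mu> w w = w" "\<mu> w j = j" "\<mu> j w = j" "\<mu> j j = \<delta> *\<^sub>R w"
    "det2 w j \<noteq> 0" "0 < s * \<delta>"
proof -
  have bil: "bilinear \<mu>" and comm: "\<And>x y. \<mu> x y = \<mu> y x"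
    and assoc: "\<And>x y z. \<mu> (\<mu> x y) z = \<mu> x (\<mu> y z)"
    using \<mu> by (auto simp: comm_assoc_laws_def)
  note bil_simps = bilinear_ladd[OF bil] bilinear_radd[OF bil] bilinear_lmul[OF bil]
    bilinear_rmul[OF bil] bilinear_lsub[OF bil] bilinear_rsub[OF bil]
  define y z where "y = \<mu> x x" and "z = \<mu> x y"
  define d where "d = det2 x y"
  define a b where "a = det2 x z / d" and "b = det2 z y / d"
  have d: "d \<noteq> 0" and b: "b \<noteq> 0"
    and disc: "0 < s * ((det2 x z)\<^sup>2 + 4 * d * det2 z y)"
    using x by (auto simp: generic_at_def y_def z_def d_def b_def)
  have "s * ((det2 x z)\<^sup>2 + 4 * d * det2 z y) = d\<^sup>2 * (s * (a\<^sup>2 + 4 * b))"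
    using d by (simp add: a_def b_def power2_eq_square field_simps)
  with disc have \<delta>: "0 < s * (a\<^sup>2 + 4 * b)"
    using d by (simp add: zero_less_mult_iff)
  have xy: "\<mu> x y = b *\<^sub>R x + a *\<^sub>R y"
    using det2_expansion[of x y z] d by (simp add: a_def b_def d_def z_def)
  \<comment> \<open>The relation reads \<open>x (y - a x) = b x\<close>, so dividing
    \<open>y - a x\<close> by \<open>b\<close> gives an element that fixes \<open>x\<close>.\<close>
  define w where "w = (1 / b) *\<^sub>R (y - a *\<^sub>R x)"
  \<comment> \<open>The derivative of \<open>t\<^sup>2 - a t - b\<close> at \<open>x\<close>:
    \<open>j\<^sup>2 = 4 (y - a x) + a\<^sup>2 w = (a\<^sup>2 + 4 b) w\<close>.\<close>
  define j where "j = 2 *\<^sub>R x - a *\<^sub>R w"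
  have y: "y = b *\<^sub>R w + a *\<^sub>R x"
    using b by (simp add: w_def)
  have wx: "\<mu> w x = x"
    using b by (simp add: w_def bil_simps comm[of y x] xy flip: y_def)
  have wy: "\<mu> w y = y"
    by (metis assoc wx y_def)
  have ww: "\<mu> w w = w"
  proof -
    have "\<mu> w w = (1 / b) *\<^sub>R (\<mu> w y - a *\<^sub>R \<mu> w x)"
      by (subst (2) w_def) (simp only: bil_simps)
    then show ?thesis by (simp only: wx wy w_def[symmetric])
  qed
  have wj: "\<mu> w j = j"
    by (simp add: j_def bil_simps ww wx)
  have "\<mu> j j = (a\<^sup>2 + 4 * b) *\<^sub>R w"
    unfolding j_def
    by (simp add: bil_simps ww wx comm[of x w] flip: y_def)
      (simp add: y vec_eq_iff algebra_simps power2_eq_square)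
  moreover have "det2 w j \<noteq> 0"
  proof -
    have "det2 w j = - (2 / b) * d"
      by (simp add: d_def j_def w_def det2_def algebra_simps)
    then show ?thesis using b d by simp
  qed
  ultimately show thesis
    using that[OF ww wj _ _ _ \<delta>] wj comm[of j w] by simp
qed

text \<open>In \<open>mu1\<close> the unit is \<open>e1\<close> and \<open>e2\<close> is a
  nontrivial idempotent. For \<open>\<delta> > 0\<close> such an idempotent is
  \<open>(w + j / sqrt \<delta>) / 2\<close>. Conversely, multiplication by \<open>e1 + e2\<close>
  in \<open>mu1\<close> has the distinct nonzero eigenvalues 1 and 2.\<close>

lemma orbit_mu1_eq: "orbit mu1 = {\<mu> \<in> comm_assoc_laws. \<exists>x. generic_at 1 \<mu> x}"
proof (intro equalityI subsetI)
  fix \<mu> assume "\<mu> \<in> orbit mu1"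
  moreover have "generic_at 1 mu1 (vector [1, 1])"
    by (simp add: generic_at_def mu1_def comm_law2_def det2_def axis_def)
  ultimately show "\<mu> \<in> {\<mu> \<in> comm_assoc_laws. \<exists>x. generic_at 1 \<mu> x}"
    using orbit_generic_at orbit_subset_comm_assoc_laws mu_comm_assoc(1) by blast
next
  fix \<mu> :: "2 law"
  assume "\<mu> \<in> {\<mu> \<in> comm_assoc_laws. \<exists>x. generic_at 1 \<mu> x}"
  then obtain x where \<mu>: "\<mu> \<in> comm_assoc_laws" and x: "generic_at 1 \<mu> x" by blast
  have bil: "bilinear \<mu>" using \<mu> by (simp add: comm_assoc_laws_def)
  note bil_simps = bilinear_ladd[OF bil] bilinear_radd[OF bil] bilinear_lmul[OF bil]
    bilinear_rmul[OF bil]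
  obtain w j \<delta> where
    ww: "\<mu> w w = w" and wj: "\<mu> w j = j" "\<mu> j w = j" and jj: "\<mu> j j = \<delta> *\<^sub>R w"
    and det: "det2 w j \<noteq> 0" and \<delta>: "0 < 1 * \<delta>"
    using generic_at_unit_and_root[OF \<mu> x] by blast
  define c where "c = 1 / (2 * sqrt \<delta>)"
  have c: "c \<noteq> 0" "c * c * \<delta> = 1 / 4"
    using \<delta> by (simp_all add: c_def)
  define v where "v = (1 / 2) *\<^sub>R w + c *\<^sub>R j"
  have "det2 w v = c * det2 w j"
    by (simp add: v_def det2_def algebra_simps)
  moreover have "\<mu> v v = v"
  proof -
    have "\<mu> v v = (1 / 4 + c * c * \<delta>) *\<^sub>R w + c *\<^sub>R j"
      by (simp add: v_def bil_simps ww wj jj vec_eq_iff algebra_simps)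
    then show ?thesis by (simp add: c v_def)
  qed
  moreover have "\<mu> w v = v" "\<mu> v w = v"
    by (simp_all add: v_def bil_simps ww wj)
  ultimately show "\<mu> \<in> orbit mu1"
    \<comment> \<open>Here \<open>w\<close> takes the role of \<open>e1\<close> and \<open>v\<close>
      that of \<open>e2\<close>.\<close>
    unfolding mu1_def using c det ww by (intro mem_orbit_comm_law2[OF bil, of v w]) (auto simp: axis_def)
qed

text \<open>For \<open>\<delta> < 0\<close> the rescaled \<open>j / sqrt (- \<delta>)\<close>
  squares to \<open>- w\<close> and serves as the imaginary unit. The witness for \<open>mu3\<close>
  itself is the complex number \<open>1 + i\<close>.\<close>

lemma orbit_mu3_eq: "orbit mu3 = {\<mu> \<in> comm_assoc_laws. \<exists>x. generic_at (- 1) \<mu> x}"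
proof (intro equalityI subsetI)
  fix \<mu> assume "\<mu> \<in> orbit mu3"
  moreover have "generic_at (- 1) mu3 (vector [1, 1])"
    by (simp add: generic_at_def mu3_def comm_law2_def det2_def axis_def)
  ultimately show "\<mu> \<in> {\<mu> \<in> comm_assoc_laws. \<exists>x. generic_at (- 1) \<mu> x}"
    using orbit_generic_at orbit_subset_comm_assoc_laws mu_comm_assoc(3) by blast
next
  fix \<mu> :: "2 law"
  assume "\<mu> \<in> {\<mu> \<in> comm_assoc_laws. \<exists>x. generic_at (- 1) \<mu> x}"
  then obtain x where \<mu>: "\<mu> \<in> comm_assoc_laws" and x: "generic_at (- 1) \<mu> x" by blast
  have bil: "bilinear \<mu>" using \<mu> by (simp add: comm_assoc_laws_def)
  obtain w j \<delta> where
    ww: "\<mu> w w = w" and wj: "\<mu> w j = j" "\<mu> j w = j" and jj: "\<mu> j j = \<delta> *\<^sub>R w"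
    and det: "det2 w j \<noteq> 0" and \<delta>: "0 < - 1 * \<delta>"
    using generic_at_unit_and_root[OF \<mu> x] by blast
  define c where "c = 1 / sqrt (- \<delta>)"
  have c: "c \<noteq> 0" "c * (c * \<delta>) = - 1"
    using \<delta> by (simp_all add: c_def field_simps)
  have "det2 w (c *\<^sub>R j) = c * det2 w j"
    by (simp add: det2_def algebra_simps)
  then show "\<mu> \<in> orbit mu3"
    unfolding mu3_def using c det
    by (intro mem_orbit_comm_law2[OF bil, of "c *\<^sub>R j" w])
      (auto simp: axis_def ww wj jj bilinear_lmul[OF bil] bilinear_rmul[OF bil])
qed

lemma openin_generic_at: "openin law_topology {\<mu> \<in> comm_assoc_laws. \<exists>x. generic_at s \<mu> x}"
proof -
  have "open {C. generic_at s (law_of_constants C) x}" for x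
    unfolding generic_at_def det2_def
    by (intro open_Collect_conj open_Collect_neq open_Collect_less continuous_intros)
  \<comment> \<open>The existential quantifier over \<open>x\<close> becomes a union of open
    sets.\<close>
  then have "open (\<Union>x. {C. generic_at s (law_of_constants C) x})"
    by blast
  from openin_law_topologyI[OF this] show ?thesis
    by (rule back_subst[of "openin law_topology"])
      (auto simp: comm_assoc_laws_def law_of_structure_constants)
qed

section \<open>Degenerations\<close>

text \<open>The structure constants depend continuously on the three basis products, so it suffices
  that these converge. The bound \<open>t < 1\<close> leaves room for witnesses that degenerate at
  \<open>t = 1\<close>.\<close>

lemma comm_law2_mem_closure:
  assumes "comm_law2 p q r \<in> comm_assoc_laws" "\<nu> \<in> comm_assoc_laws"
    and "(P \<longlongrightarrow> p) (at_right 0)" "(Q \<longlongrightarrow> q) (at_right 0)" "(R \<longlongrightarrow> r) (at_right (0::real))"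
    and ev: "\<And>t. 0 < t \<Longrightarrow> t < 1 \<Longrightarrow> comm_law2 (P t) (Q t) (R t) \<in> orbit \<nu>"
  shows "comm_law2 p q r \<in> law_topology closure_of orbit \<nu>"
proof (rule mem_closure_of_law_topology[where F = "at_right 0"])
  show "((\<lambda>t. structure_constants (comm_law2 (P t) (Q t) (R t))) \<longlongrightarrow>
      structure_constants (comm_law2 p q r)) (at_right 0)"
    unfolding structure_constants_def comm_law2_def
    by (intro tendsto_vec_lambda tendsto_intros assms)
  have "\<forall>\<^sub>F t in at_right (0::real). 0 < t \<and> t < 1"
    by (auto simp: eventually_at_right_field intro!: exI[of _ 1])
  then show "\<forall>\<^sub>F t in at_right 0. comm_law2 (P t) (Q t) (R t) \<in> orbit \<nu> \<inter> comm_assoc_laws"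
    by eventually_elim (use ev orbit_subset_comm_assoc_laws[OF assms(2)] in blast)
qed (use assms in auto)

lemma comm_law2_comm_assocI:
  assumes "\<And>x y z. comm_law2 p q r (comm_law2 p q r x y) z = comm_law2 p q r x (comm_law2 p q r y z)"
  shows "comm_law2 p q r \<in> comm_assoc_laws"
  using assms unfolding comm_assoc_laws_def bilinear_def
  by (auto simp: comm_law2_def vec_eq_iff forall_2 algebra_simps intro!: linearI)

lemma tendsto_scaleR_at_right_0:
  fixes v :: "'a::real_normed_vector"
  shows "((\<lambda>t. t *\<^sub>R v) \<longlongrightarrow> 0) (at_right 0)"
  using tendsto_scaleR[OF tendsto_ident_at[of 0 "{0<..}"] tendsto_const[of v]] by simp

text \<open>Deform \<open>e2\<^sup>2 = 0\<close> to \<open>e2\<^sup>2 = t e1\<close>: for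
  \<open>t > 0\<close> the double root splits into the two roots \<open>sqrt t\<close> and
  \<open>- sqrt t\<close>.\<close>

lemma mu2_mem_closure: "mu2 \<in> law_topology closure_of orbit mu1"
  unfolding mu2_def
proof (rule comm_law2_mem_closure)
  fix t :: real assume t: "0 < t" "t < 1"
  have "comm_law2 e1 e2 (t *\<^sub>R e1) \<in> comm_assoc_laws"
    by (rule comm_law2_comm_assocI)
      (simp add: comm_law2_def vec_eq_iff forall_2 axis_def algebra_simps)
  moreover have "generic_at 1 (comm_law2 e1 e2 (t *\<^sub>R e1)) (vector [1, 1])"
  proof -
    \<comment> \<open>With \<open>x = e1 + e2\<close>, the first left side is
      \<open>- det2 x\<^sup>3 x\<^sup>2\<close> and the second is the discriminant expression of
      \<open>generic_at\<close>.\<close>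
    have "(3 + t) * (1 + t) - (6 * t + 2) = (1 - t)\<^sup>2"
      and "(2 - 2 * t)\<^sup>2 + (4 - 4 * t) * (6 * t + 2 - (3 + t) * (1 + t)) = 4 * t * (1 - t)\<^sup>2"
      by algebra+
    moreover have "0 < (1 - t)\<^sup>2" using t by simp
    ultimately have "6 * t + 2 \<noteq> (3 + t) * (1 + t)"
      and "0 < (2 - 2 * t)\<^sup>2 + (4 - 4 * t) * (6 * t + 2 - (3 + t) * (1 + t))"
      using t by (linarith, simp)
    then show ?thesis
      using t by (simp add: generic_at_def comm_law2_def det2_def axis_def)
  qed
  ultimately show "comm_law2 e1 e2 (t *\<^sub>R e1) \<in> orbit mu1"
    by (auto simp: orbit_mu1_eq)
qed (auto simp: mu_comm_assoc(1) mu_comm_assoc(2)[unfolded mu2_def] intro: tendsto_scaleR_at_right_0)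

text \<open>The curve makes \<open>e1\<close> satisfy \<open>x\<^sup>3 = t x\<close>, so
  \<open>a = 0\<close> and \<open>b = t\<close>; at \<open>t = 0\<close> it becomes
  nilpotent.\<close>

lemma mu4_mem_closure: "mu4 \<in> law_topology closure_of orbit mu1"
  unfolding mu4_def
proof (rule comm_law2_mem_closure)
  fix t :: real assume t: "0 < t" "t < 1"
  have "comm_law2 e2 (t *\<^sub>R e1) (t *\<^sub>R e2) \<in> comm_assoc_laws"
    by (rule comm_law2_comm_assocI)
      (simp add: comm_law2_def vec_eq_iff forall_2 axis_def algebra_simps)
  moreover have "generic_at 1 (comm_law2 e2 (t *\<^sub>R e1) (t *\<^sub>R e2)) e1"
    using t by (simp add: generic_at_def comm_law2_def det2_def axis_def)
  ultimately show "comm_law2 e2 (t *\<^sub>R e1) (t *\<^sub>R e2) \<in> orbit mu1"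
    by (auto simp: orbit_mu1_eq)
qed (auto simp: mu_comm_assoc(1) mu_comm_assoc(4)[unfolded mu4_def] intro: tendsto_scaleR_at_right_0)

text \<open>The curve is \<open>t\<close> times \<open>mu1\<close>, which shrinks to the zero
  law.\<close>

lemma mu5_mem_closure: "mu5 \<in> law_topology closure_of orbit mu1"
  unfolding mu5_def
proof (rule comm_law2_mem_closure)
  fix t :: real assume t: "0 < t" "t < 1"
  have "comm_law2 (t *\<^sub>R e1) (t *\<^sub>R e2) (t *\<^sub>R e2) \<in> comm_assoc_laws"
    by (rule comm_law2_comm_assocI)
      (simp add: comm_law2_def vec_eq_iff forall_2 axis_def algebra_simps)
  moreover have "generic_at 1 (comm_law2 (t *\<^sub>R e1) (t *\<^sub>R e2) (t *\<^sub>R e2)) (vector [1, 1])"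
  proof -
    \<comment> \<open>Both sides are a quarter of the discriminant expression
      \<open>36 t\<^sup>4 - 32 t\<^sup>4\<close> at \<open>x = e1 + e2\<close>.\<close>
    have "9 * (t * t)\<^sup>2 - 8 * (t * (t * (t * t))) = (t * t)\<^sup>2"
      by algebra
    moreover have "0 < (t * t)\<^sup>2" using t by simp
    ultimately have "8 * (t * (t * (t * t))) < 9 * (t * t)\<^sup>2" by linarith
    then show ?thesis
      using t by (simp add: generic_at_def comm_law2_def det2_def axis_def)
  qed
  ultimately show "comm_law2 (t *\<^sub>R e1) (t *\<^sub>R e2) (t *\<^sub>R e2) \<in> orbit mu1"
    by (auto simp: orbit_mu1_eq)
qed (auto simp: mu_comm_assoc(1) mu_comm_assoc(5)[unfolded mu5_def] intro: tendsto_scaleR_at_right_0)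

text \<open>Giving \<open>e2\<close> the square \<open>t e2\<close> yields a product of two lines
  with idempotents \<open>e1\<close> and \<open>e2 / t\<close>. Multiplication by
  \<open>e1 + e2\<close> has eigenvalues 1 and \<open>t\<close>, distinct for
  \<open>t < 1\<close>.\<close>

lemma mu6_mem_closure: "mu6 \<in> law_topology closure_of orbit mu1"
  unfolding mu6_def
proof (rule comm_law2_mem_closure)
  fix t :: real assume t: "0 < t" "t < 1"
  have "comm_law2 e1 0 (t *\<^sub>R e2) \<in> comm_assoc_laws"
    by (rule comm_law2_comm_assocI)
      (simp add: comm_law2_def vec_eq_iff forall_2 axis_def algebra_simps)
  moreover have "generic_at 1 (comm_law2 e1 0 (t *\<^sub>R e2)) (vector [1, 1])"
  proof -
    have eq: "(t * t - 1)\<^sup>2 + (4 * t - 4) * (t - t * t) = ((1 - t)\<^sup>2)\<^sup>2"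
      by algebra
    have "0 < (t * t - 1)\<^sup>2 + (4 * t - 4) * (t - t * t)"
      unfolding eq using t by simp
    then show ?thesis
      using t by (simp add: generic_at_def comm_law2_def det2_def axis_def)
  qed
  ultimately show "comm_law2 e1 0 (t *\<^sub>R e2) \<in> orbit mu1"
    by (auto simp: orbit_mu1_eq)
qed (auto simp: mu_comm_assoc(1) mu_comm_assoc(6)[unfolded mu6_def] intro: tendsto_scaleR_at_right_0)

theorem theorem4p3:
  shows "let A1 = affine_structure_of_law mu1;
             A2 = affine_structure_of_law mu2;
             A3 = affine_structure_of_law mu3;
             A4 = affine_structure_of_law mu4;
             A5 = affine_structure_of_law mu5;
             A6 = affine_structure_of_law mu6
         in rigid_affine_structure A1 \<and> rigid_affine_structure A3 \<and>
            (\<forall>B \<in> {A2, A4, A5, A6}. deformable_into B A1 \<or> deformable_into B A3)"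
proof -
  have "openin law_topology (orbit mu1)" "openin law_topology (orbit mu3)"
    by (simp_all add: orbit_mu1_eq orbit_mu3_eq openin_generic_at)
  \<comment> \<open>\<open>affine_product_of_law\<close> recovers each law from its affine
    structure, so both claims become statements about orbits of laws.\<close>
  then show ?thesis
    by (simp add: Let_def rigid_affine_structure_def rigid_law_def deformable_into_def
        affine_structure_of_law affine_product_of_law mu_comm_assoc mu2_mem_closure
        mu4_mem_closure mu5_mem_closure mu6_mem_closure)
qed

end
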